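(* An implicative-orthomodular algebra $(X,\to,^*,1)$ is a Wajsberg algebra if and only if it satisfies the following conditions for all $x,y\in X$: (1) $x\le_Q x\Cup y$; (2) $(x\Cup y)\to x=y\to x$.
   Context: A BE algebra is an algebra $(X,\to,1)$ of type $(2,0)$ such that for all $x,y,z\in X$: $x\to x=1$; $x\to 1=1$; $1\to x=x$; $x\to (y\to z)=y\to (x\to z)$. Write $x\le y$ iff $x\to y=1$. It is bounded if there is $0\in X$ with $0\le x$ for all $x\in X$; then $x^*:=x\to 0$. It is involutive if it is bounded and $x^{**}=x$ for all $x\in X$; an involutive BE algebra is denoted $(X,\to,^*,1)$. In an involutive BE algebra define $x\Cup y=(x\to y)\to y$, $x\Cap y=((x^*\to y^* )\to y^* )^*$, and $x\le_Q y$ iff $x=x\Cap y$. An implicative-orthomodular algebra is an involutive BE algebra satisfying $x\to (y\Cap (z\Cap x))=(x\to y)\Cap (x\to z)$ for all $x,y,z\in X$. A Wajsberg algebra is an algebra $(X,\to,^*,1)$ of type $(2,1,0)$ such that for all $x,y,z\in X$: $1\to x=x$; $(y\to z)\to ((z\to x)\to (y\to x))=1$; $(x\to y)\to y=(y\to x)\to x$; $(x^*\to y^* )\to (y\to x)=1$. *)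

theory Defs
  imports Main
begin

text \<open>Algebras are given by an explicit carrier \<open>X\<close>; the operations may behave arbitrarily
  outside of \<open>X\<close>.\<close>

locale BE_algebra =
  fixes X :: "'a set"
    and imp :: "'a \<Rightarrow> 'a \<Rightarrow> 'a"  (infixr "\<rightarrow>" 65)
    and one :: 'a  ("\<one>")
  assumes imp_closed: "\<lbrakk>x \<in> X; y \<in> X\<rbrakk> \<Longrightarrow> x \<rightarrow> y \<in> X"
    and one_closed: "\<one> \<in> X"
    and imp_self: "x \<in> X \<Longrightarrow> x \<rightarrow> x = \<one>"
    and imp_one: "x \<in> X \<Longrightarrow> x \<rightarrow> \<one> = \<one>"
    and one_imp: "x \<in> X \<Longrightarrow> \<one> \<rightarrow> x = x"
    and imp_exchange: "\<lbrakk>x \<in> X; y \<in> X; z \<in> X\<rbrakk> \<Longrightarrow> x \<rightarrow> (y \<rightarrow> z) = y \<rightarrow> (x \<rightarrow> z)"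
begin

definition le :: "'a \<Rightarrow> 'a \<Rightarrow> bool"  (infix "\<preceq>" 50)
  where "x \<preceq> y \<longleftrightarrow> x \<rightarrow> y = \<one>"

end

locale bounded_BE_algebra = BE_algebra +
  fixes zero :: 'a  ("\<zero>")
  assumes zero_closed: "\<zero> \<in> X"
    and zero_le: "x \<in> X \<Longrightarrow> \<zero> \<preceq> x"

text \<open>The signature of an involutive BE algebra contains \<open>star\<close> but not \<open>0\<close>: the operation
  \<open>star\<close> is required to be \<open>x \<mapsto> x \<rightarrow> 0\<close> on \<open>X\<close> for some least element \<open>0\<close>
  (which is unique by involutivity).\<close>

locale involutive_BE_algebra = BE_algebra X imp one
  for X :: "'a set"
    and imp :: "'a \<Rightarrow> 'a \<Rightarrow> 'a"  (infixr "\<rightarrow>" 65)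
    and star :: "'a \<Rightarrow> 'a"
    and one :: 'a  ("\<one>") +
  assumes bounded_star:
      "\<exists>zero. bounded_BE_algebra X imp one zero \<and> (\<forall>x\<in>X. star x = x \<rightarrow> zero)"
    and star_star: "x \<in> X \<Longrightarrow> star (star x) = x"

definition Cup :: "('a \<Rightarrow> 'a \<Rightarrow> 'a) \<Rightarrow> 'a \<Rightarrow> 'a \<Rightarrow> 'a"
  where "Cup imp x y = imp (imp x y) y"

definition Cap :: "('a \<Rightarrow> 'a \<Rightarrow> 'a) \<Rightarrow> ('a \<Rightarrow> 'a) \<Rightarrow> 'a \<Rightarrow> 'a \<Rightarrow> 'a"
  where "Cap imp star x y = star (imp (imp (star x) (star y)) (star y))"

definition le_Q :: "('a \<Rightarrow> 'a \<Rightarrow> 'a) \<Rightarrow> ('a \<Rightarrow> 'a) \<Rightarrow> 'a \<Rightarrow> 'a \<Rightarrow> bool"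
  where "le_Q imp star x y \<longleftrightarrow> x = Cap imp star x y"

locale implicative_orthomodular_algebra = involutive_BE_algebra +
  assumes orthomodular: "\<lbrakk>x \<in> X; y \<in> X; z \<in> X\<rbrakk> \<Longrightarrow>
    x \<rightarrow> Cap imp star y (Cap imp star z x) = Cap imp star (x \<rightarrow> y) (x \<rightarrow> z)"

locale Wajsberg_algebra =
  fixes X :: "'a set"
    and imp :: "'a \<Rightarrow> 'a \<Rightarrow> 'a"  (infixr "\<rightarrow>" 65)
    and star :: "'a \<Rightarrow> 'a"
    and one :: 'a  ("\<one>")
  assumes imp_closed: "\<lbrakk>x \<in> X; y \<in> X\<rbrakk> \<Longrightarrow> x \<rightarrow> y \<in> X"
    and star_closed: "x \<in> X \<Longrightarrow> star x \<in> X"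
    and one_closed: "\<one> \<in> X"
    and one_imp: "x \<in> X \<Longrightarrow> \<one> \<rightarrow> x = x"
    and imp_trans: "\<lbrakk>x \<in> X; y \<in> X; z \<in> X\<rbrakk> \<Longrightarrow>
      (y \<rightarrow> z) \<rightarrow> ((z \<rightarrow> x) \<rightarrow> (y \<rightarrow> x)) = \<one>"
    and imp_commute: "\<lbrakk>x \<in> X; y \<in> X\<rbrakk> \<Longrightarrow> (x \<rightarrow> y) \<rightarrow> y = (y \<rightarrow> x) \<rightarrow> x"
    and contraposition: "\<lbrakk>x \<in> X; y \<in> X\<rbrakk> \<Longrightarrow> (star x \<rightarrow> star y) \<rightarrow> (y \<rightarrow> x) = \<one>"

end

theory Submission
  imports Defs
begin

text \<open>
  In an involutive BE algebra everything reduces to the commutativity \<open>x \<Cup> y = y \<Cup> x\<close>.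
  Condition (2) gives \<open>(x \<Cup> y) \<rightarrow> (y \<Cup> x) = (y \<rightarrow> x) \<rightarrow> ((x \<Cup> y) \<rightarrow> x) = (y \<rightarrow> x) \<rightarrow> (y \<rightarrow> x) = 1\<close>.
  If \<open>a \<le> b\<close>, then \<open>a \<Cup> b = b\<close>, so condition (1) gives \<open>a = a \<Cap> b\<close>; if moreover \<open>b \<le> a\<close>, then
  \<open>a \<Cap> b = b\<close>. Hence \<open>\<le>\<close> is antisymmetric and the two joins coincide.
\<close>

context involutive_BE_algebra
begin

lemma star_closed: "x \<in> X \<Longrightarrow> star x \<in> X"
  using bounded_star bounded_BE_algebra.zero_closed imp_closed by metis

text \<open>Unfolding \<open>star x\<close> as \<open>x \<rightarrow> z\<close> for the least
  element \<open>z\<close>, exchange moves \<open>x\<close> to the front and leaves the double star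
  of \<open>y\<close> behind it.\<close>

lemma imp_star_star:
  assumes "x \<in> X" "y \<in> X"
  shows "star y \<rightarrow> star x = x \<rightarrow> y"
proof -
  obtain z where b: "bounded_BE_algebra X imp one z" and s: "\<forall>x\<in>X. star x = x \<rightarrow> z"
    using bounded_star by blast
  have z: "z \<in> X"
    using b by (rule bounded_BE_algebra.zero_closed)
  have "star y \<rightarrow> star x = star y \<rightarrow> (x \<rightarrow> z)"
    using s assms by simp
  also have "\<dots> = x \<rightarrow> (star y \<rightarrow> z)"
    using assms z by (intro imp_exchange star_closed)
  also have "star y \<rightarrow> z = star (star y)"
    using s assms star_closed by simp
  finally show ?thesis
    using assms star_star by simp
qed

lemma Cap_eq:
  assumes "x \<in> X" "y \<in> X"
  shows "Cap imp star x y = star ((y \<rightarrow> x) \<rightarrow> star y)"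
  using assms by (simp add: Cap_def imp_star_star)

text \<open>By contraposition the meet is
  \<open>star ((y \<rightarrow> x) \<rightarrow> star y)\<close>, which collapses to
  \<open>star (star y)\<close> once \<open>y \<rightarrow> x\<close> is the unit.\<close>

lemma Cap_eq_right:
  assumes "x \<in> X" "y \<in> X" "y \<rightarrow> x = \<one>"
  shows "Cap imp star x y = y"
  using assms by (simp add: Cap_eq one_imp star_closed star_star)

text \<open>The one axiom that takes work is transitivity: exchange exposes the join of
  \<open>z\<close> and \<open>x\<close>, and commutativity turns it into the join of
  \<open>x\<close> and \<open>z\<close>, so that \<open>y \<rightarrow> z\<close> appears on both
  sides.\<close>

lemma Wajsberg_algebra_if_commutative:
  assumes comm: "\<And>x y. \<lbrakk>x \<in> X; y \<in> X\<rbrakk> \<Longrightarrow> (x \<rightarrow> y) \<rightarrow> y = (y \<rightarrow> x) \<rightarrow> x"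
  shows "Wajsberg_algebra X imp star \<one>"
proof
  fix x y z assume x: "x \<in> X" and y: "y \<in> X" and z: "z \<in> X"
  have "(z \<rightarrow> x) \<rightarrow> (y \<rightarrow> x) = y \<rightarrow> ((z \<rightarrow> x) \<rightarrow> x)"
    using x y z by (intro imp_exchange imp_closed)
  also have "\<dots> = y \<rightarrow> ((x \<rightarrow> z) \<rightarrow> z)"
    using comm x z by simp
  also have "\<dots> = (x \<rightarrow> z) \<rightarrow> (y \<rightarrow> z)"
    using x y z by (intro imp_exchange imp_closed)
  finally have "(y \<rightarrow> z) \<rightarrow> ((z \<rightarrow> x) \<rightarrow> (y \<rightarrow> x)) = (y \<rightarrow> z) \<rightarrow> ((x \<rightarrow> z) \<rightarrow> (y \<rightarrow> z))"
    by simp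
  also have "\<dots> = (x \<rightarrow> z) \<rightarrow> ((y \<rightarrow> z) \<rightarrow> (y \<rightarrow> z))"
    using x y z by (intro imp_exchange imp_closed)
  also have "\<dots> = \<one>"
    using x y z by (simp add: imp_self imp_one imp_closed)
  finally show "(y \<rightarrow> z) \<rightarrow> ((z \<rightarrow> x) \<rightarrow> (y \<rightarrow> x)) = \<one>" .
\<comment> \<open>The contraposition axiom becomes an instance of reflexivity, since
  \<open>imp_star_star\<close> rewrites its premise to its conclusion.\<close>
qed (simp_all add: comm imp_closed star_closed one_closed one_imp imp_star_star imp_self)

lemma Wajsberg_algebra_iff:
  "Wajsberg_algebra X imp star \<one> \<longleftrightarrow>
    (\<forall>x\<in>X. \<forall>y\<in>X. le_Q imp star x (Cup imp x y)) \<and>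
    (\<forall>x\<in>X. \<forall>y\<in>X. Cup imp x y \<rightarrow> x = y \<rightarrow> x)"
  (is "?W \<longleftrightarrow> ?C")
proof
  assume ?W
  then have comm: "(x \<rightarrow> y) \<rightarrow> y = (y \<rightarrow> x) \<rightarrow> x" if "x \<in> X" "y \<in> X" for x y
    using that by (rule Wajsberg_algebra.imp_commute)
  show ?C
  proof (intro conjI ballI)
    fix x y assume x: "x \<in> X" and y: "y \<in> X"
    let ?z = "(x \<rightarrow> y) \<rightarrow> y"
    have z: "?z \<in> X"
      using x y by (intro imp_closed)
    have "x \<rightarrow> ?z = (x \<rightarrow> y) \<rightarrow> (x \<rightarrow> y)"
      using x y by (intro imp_exchange imp_closed)
    then have xz: "x \<rightarrow> ?z = \<one>"
      using x y by (simp add: imp_self imp_closed)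
    \<comment> \<open>Commutativity is applied to the starred elements: \<open>x\<close> lies below
      \<open>?z\<close>, so \<open>star ?z \<rightarrow> star x\<close> is the unit and the
      right-hand side reduces to \<open>star x\<close>.\<close>
    have "(star x \<rightarrow> star ?z) \<rightarrow> star ?z = (star ?z \<rightarrow> star x) \<rightarrow> star x"
      using x z by (intro comm star_closed)
    also have "\<dots> = star x"
      using x z by (simp add: imp_star_star xz one_imp star_closed)
    finally show "le_Q imp star x (Cup imp x y)"
      using x by (simp add: le_Q_def Cup_def Cap_def star_star)
    have "x \<rightarrow> (y \<rightarrow> x) = y \<rightarrow> (x \<rightarrow> x)"
      using x y by (intro imp_exchange)
    then have yx: "x \<rightarrow> (y \<rightarrow> x) = \<one>"
      using x y by (simp add: imp_self imp_one)
    \<comment> \<open>Commutativity is used twice: first to swap the join, then on the pair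
      \<open>y \<rightarrow> x\<close> and \<open>x\<close>, where \<open>x\<close> lies below
      \<open>y \<rightarrow> x\<close>.\<close>
    have "Cup imp x y \<rightarrow> x = ((y \<rightarrow> x) \<rightarrow> x) \<rightarrow> x"
      using comm x y by (simp add: Cup_def)
    also have "\<dots> = (x \<rightarrow> (y \<rightarrow> x)) \<rightarrow> (y \<rightarrow> x)"
      using x y by (intro comm imp_closed)
    finally show "Cup imp x y \<rightarrow> x = y \<rightarrow> x"
      using x y by (simp add: yx one_imp imp_closed)
  qed
next
  assume ?C
  then have le_Q_Cup: "x = Cap imp star x ((x \<rightarrow> y) \<rightarrow> y)"
    and Cup_imp: "((x \<rightarrow> y) \<rightarrow> y) \<rightarrow> x = y \<rightarrow> x" if "x \<in> X" "y \<in> X" for x y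
    using that by (simp_all add: le_Q_def Cup_def)
  have antisym: "a = b" if "a \<in> X" "b \<in> X" "a \<rightarrow> b = \<one>" "b \<rightarrow> a = \<one>" for a b
    using le_Q_Cup[of a b] that by (simp add: one_imp Cap_eq_right)
  have Cup_le: "((x \<rightarrow> y) \<rightarrow> y) \<rightarrow> ((y \<rightarrow> x) \<rightarrow> x) = \<one>" if x: "x \<in> X" and y: "y \<in> X" for x y
  proof -
    have "((x \<rightarrow> y) \<rightarrow> y) \<rightarrow> ((y \<rightarrow> x) \<rightarrow> x) = (y \<rightarrow> x) \<rightarrow> (((x \<rightarrow> y) \<rightarrow> y) \<rightarrow> x)"
      using x y by (intro imp_exchange imp_closed)
    then show ?thesis
      using x y by (simp add: Cup_imp imp_self imp_closed)
  qed
  show ?W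
    \<comment> \<open>The two inequalities required by \<open>antisym\<close> are
      \<open>Cup_le\<close> and its instance with \<open>x\<close> and \<open>y\<close>
      interchanged.\<close>
    by (rule Wajsberg_algebra_if_commutative, rule antisym) (simp_all add: Cup_le imp_closed)
qed

end

theorem theorem4p7:
  fixes X :: "'a set"
    and imp :: "'a \<Rightarrow> 'a \<Rightarrow> 'a"
    and star :: "'a \<Rightarrow> 'a"
    and one :: 'a
  assumes "implicative_orthomodular_algebra X imp star one"
  shows "Wajsberg_algebra X imp star one \<longleftrightarrow>
    (\<forall>x\<in>X. \<forall>y\<in>X. le_Q imp star x (Cup imp x y)) \<and>
    (\<forall>x\<in>X. \<forall>y\<in>X. imp (Cup imp x y) x = imp y x)"
  using assms
  by (intro involutive_BE_algebra.Wajsberg_algebra_iff implicative_orthomodular_algebra.axioms(1))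

end
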